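(* Let $k\ge 0$, $a\ge 1$ and $b\ge 0$ be integers. Then the arithmetic function $g_{k,a,b}$ is periodic, and $L_k$ is a period of $g_{k,a,b}$.
   Context: For integers $k\ge 0$, $a\ge 1$, $b\ge 0$, the function $g_{k,a,b}$ from the positive integers to the positive integers is $$g_{k,a,b}(n)=\frac{(b+na)(b+(n+1)a)\cdots(b+(n+k)a)}{\operatorname{lcm}(b+na,\,b+(n+1)a,\,\ldots,\,b+(n+k)a)}.$$ A period of a function $f$ on the positive integers is a positive integer $T$ with $f(n+T)=f(n)$ for all positive integers $n$; $f$ is periodic if it has a period. Set $L_0:=1$ and $L_k:=\operatorname{lcm}(1,2,\ldots,k)$ for $k\ge 1$. *)

theory Defs
  imports Main
begin

(* Functions on the positive integers are represented as functions on nat;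
   their value at 0 is irrelevant and is never constrained. *)

definition is_period :: "(nat \<Rightarrow> 'a) \<Rightarrow> nat \<Rightarrow> bool" where
  "is_period f T \<longleftrightarrow> T > 0 \<and> (\<forall>n>0. f (n + T) = f n)"

definition periodic :: "(nat \<Rightarrow> 'a) \<Rightarrow> bool" where
  "periodic f \<longleftrightarrow> (\<exists>T. is_period f T)"

(* The div is an exact division, see g_exact below. *)
definition g :: "nat \<Rightarrow> nat \<Rightarrow> nat \<Rightarrow> nat \<Rightarrow> nat" where
  "g k a b n = (\<Prod>i\<in>{0..k}. b + (n + i) * a) div (LCM i\<in>{0..k}. b + (n + i) * a)"

(* The convention L 0 = 1 is the value of the empty Lcm, see L_0 below. *)
definition L :: "nat \<Rightarrow> nat" where
  "L k = Lcm {1..k}"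

lemma L_0: "L 0 = 1"
  by (simp add: L_def)

lemma g_exact:
  "g k a b n * (LCM i\<in>{0..k}. b + (n + i) * a) = (\<Prod>i\<in>{0..k}. b + (n + i) * a)"
proof -
  have "(LCM i\<in>{0..k}. b + (n + i) * a) dvd (\<Prod>i\<in>{0..k}. b + (n + i) * a)"
    by (rule Lcm_least) (auto intro!: dvd_prodI simp del: mult_Suc_right)
  then show ?thesis
    unfolding g_def by (rule dvd_div_mult_self)
qed

lemma g_pos:
  assumes "a \<ge> 1" and "n > 0"
  shows "g k a b n > 0"
proof -
  have "(\<Prod>i\<in>{0..k}. b + (n + i) * a) > 0"
    using assms by (intro prod_pos) auto
  then show ?thesis
    using g_exact[of k a b n] by (metis gr0I mult_zero_left less_irrefl)
qed

end

theory Submission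
  imports Defs "HOL-Computational_Algebra.Euclidean_Algorithm"
begin

text \<open>
  The quotient of a product by a least common multiple depends only on the pairwise greatest
  common divisors of the factors. Indeed, adjoining a factor $y$ to $x_0,\ldots,x_{j-1}$ multiplies
  the product by $y$ and the least common multiple $M$ by $y/\gcd(y,M)$, hence the quotient by
  $\gcd(y,M)$; as divisibility is a distributive lattice, $\gcd(y,M)$ is the least common
  multiple of the numbers $\gcd(y,x_i)$ (\<open>prod_eq_Lcm_times_prod_Lcm_gcd\<close>).

  Here the factors are $x_i=b+(n+i)a$ for $0\le i\le k$. For $i<j$ the Euclidean step turns
  $\gcd(x_j,x_i)$ into $\gcd((j-i)a,x_i)$. Replacing $n$ by $n+L_k$ adds $L_k a$ to $x_i$, and
  this is a multiple of $(j-i)a$, since $1\le j-i\le k$ gives $j-i\mid L_k$. So every pairwise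
  greatest common divisor is unchanged (\<open>gcd_progression_shift\<close>), and with them the value
  of $g_{k,a,b}$.
\<close>

lemma gcd_Lcm_distrib:
  fixes y :: "'a::{factorial_semiring_gcd,semiring_Gcd}"
  assumes "finite A"
  shows "gcd y (Lcm A) = (LCM x\<in>A. gcd y x)"
  using assms by (induction A) (simp_all add: gcd_lcm_distrib)

text \<open>
  Written multiplicatively rather than as a quotient, the identity holds even if some $x_i$ vanish.
  With $y=x_m$ and $M$ the least common multiple of the earlier terms, the induction step combines
  $y M = \mathrm{lcm}(y,M)\gcd(y,M)$ with distributivity.
\<close>

lemma prod_eq_Lcm_times_prod_Lcm_gcd:
  fixes x :: "nat \<Rightarrow> nat"
  shows "(\<Prod>i<m. x i) = (LCM i\<in>{..<m}. x i) * (\<Prod>j<m. LCM i\<in>{..<j}. gcd (x j) (x i))"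
proof (induction m)
  case 0
  show ?case by simp
next
  case (Suc m)
  let ?M = "LCM i\<in>{..<m}. x i" and ?G = "\<Prod>j<m. LCM i\<in>{..<j}. gcd (x j) (x i)"
  have "(\<Prod>i<Suc m. x i) = (x m * ?M) * ?G"
    using Suc.IH by simp
  also have "x m * ?M = lcm (x m) ?M * gcd (x m) ?M"
    by simp
  also have "gcd (x m) ?M = (LCM i\<in>{..<m}. gcd (x m) (x i))"
    by (simp add: gcd_Lcm_distrib image_image)
  finally show ?case
    by (simp add: lessThan_Suc mult.assoc)
qed

lemma g_eq_prod_Lcm_gcd:
  assumes "a \<ge> 1" and "n > 0"
  shows "g k a b n =
    (\<Prod>j<Suc k. LCM i\<in>{..<j}. gcd (b + (n + j) * a) (b + (n + i) * a))"
proof -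
  let ?x = "\<lambda>i. b + (n + i) * a"
  have "0 \<notin> ?x ` {..<Suc k}"
    using assms by auto
  then have "(LCM i\<in>{..<Suc k}. ?x i) \<noteq> 0"
    by (simp add: Lcm_0_iff)
  moreover have "{0..k} = {..<Suc k}"
    by auto
  ultimately show ?thesis
    unfolding g_def using prod_eq_Lcm_times_prod_Lcm_gcd[of ?x "Suc k"]
    by (simp del: prod.lessThan_Suc)
qed

text \<open>
  By the Euclidean step the first argument becomes the difference $(j-i)a$, which does not involve
  $n$; the second argument then matters only modulo $(j-i)a$, and $Ta$ vanishes modulo that number.
\<close>

lemma gcd_progression_shift:
  fixes a b n i j T :: nat
  assumes "i < j" and "j - i dvd T"
  shows "gcd (b + (n + T + j) * a) (b + (n + T + i) * a)
    = gcd (b + (n + j) * a) (b + (n + i) * a)"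
proof -
  have euclid: "gcd (b + (m + j) * a) (b + (m + i) * a) = gcd ((j - i) * a) (b + (m + i) * a)" for m
  proof -
    obtain d where "j = i + d"
      using assms(1) less_imp_add_positive by blast
    then have "b + (m + j) * a = (j - i) * a + (b + (m + i) * a)"
      by (simp add: algebra_simps)
    then show ?thesis by (simp only: gcd_add1)
  qed
  obtain c where "T = (j - i) * c"
    using assms(2) by blast
  then have "T * a = c * ((j - i) * a)"
    by simp
  then have "b + (n + T + i) * a = c * ((j - i) * a) + (b + (n + i) * a)"
    by (metis add.assoc add.left_commute add_mult_distrib)
  then have "gcd ((j - i) * a) (b + (n + T + i) * a) = gcd ((j - i) * a) (b + (n + i) * a)"
    by (simp only: gcd_add_mult)
  then show ?thesis by (simp only: euclid)
qed

theorem theorem2p5: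
  fixes k a b :: nat
  assumes "a \<ge> 1"
  shows "periodic (g k a b) \<and> is_period (g k a b) (L k)"
proof -
  have L_pos: "L k > 0"
    unfolding L_def by (simp add: Lcm_0_iff flip: neq0_conv)
  have "g k a b (n + L k) = g k a b n" if "n > 0" for n
  proof -
    have "gcd (b + (n + L k + j) * a) (b + (n + L k + i) * a)
        = gcd (b + (n + j) * a) (b + (n + i) * a)" if "j < Suc k" "i < j" for i j
    proof (rule gcd_progression_shift)
      show "j - i dvd L k"
        unfolding L_def using that by (intro dvd_Lcm) auto
    qed (rule that)
    then show ?thesis
      using assms \<open>n > 0\<close> by (simp add: g_eq_prod_Lcm_gcd del: prod.lessThan_Suc)
  qed
  with L_pos have "is_period (g k a b) (L k)"
    by (simp add: is_period_def)
  then show ?thesis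
    by (auto simp: periodic_def)
qed

end
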